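(* Let $(\mathcal{X},\mathcal{A},L)$ be a basic game and $\Gamma\subseteq\mathcal{P}$ a family of distributions. Suppose that a saddle-point $(P^*,\zeta^* )\in\Gamma\times\mathcal{Z}$ exists in the restricted game $\mathcal{G}^\Gamma=(\Gamma,\mathcal{A},L)$, and let $H^*:=L(P^*,\zeta^* )$. Then: (i) the game $\mathcal{G}^\Gamma$ has value $H^*=L(P^*,\zeta^* )$; (ii) $\zeta^*$ is Bayes against $P^*$; (iii) $H(P^* )=H^*$; (iv) $P^*$ maximizes the entropy $H(P)$ over $P\in\Gamma$; (v) $\zeta^*$ is robust Bayes against $\Gamma$.
   Context: A basic game $(\mathcal{X},\mathcal{A},L)$ consists of measurable spaces $\mathcal{X}$ (outcomes) and $\mathcal{A}$ (actions), whose $\sigma$-fields contain all singletons, and a jointly measurable loss function $L:\mathcal{X}\times\mathcal{A}\to(-\infty,\infty]$. Expectations are taken in the extended sense $E f=E f^+-E f^-$, defined unless both terms are infinite. For a probability distribution $P$ on $\mathcal{X}$ and $a\in\mathcal{A}$, $L(P,a):=E_P\{L(X,a)\}$. $\mathcal{P}$ is the set of all probability distributions $P$ on $\mathcal{X}$ such that $L(P,a)$ is defined for all $a\in\mathcal{A}$. For a randomized act $\zeta$ (a probability distribution on $\mathcal{A}$), $L(x,\zeta):=E_{A\sim\zeta}\{L(x,A)\}$ and $L(P,\zeta):=E_{(X,A)\sim P\times\zeta}\{L(X,A)\}$; $\mathcal{Z}$ is the set of all $\zeta$ such that $L(P,\zeta)$ is defined for all $P\in\mathcal{P}$. Elements of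 $\mathcal{A}$ are identified with point masses. An act $\zeta_P\in\mathcal{Z}$ is Bayes against $P$ if $E_P\{L(X,\zeta)-L(X,\zeta_P)\}\in[0,\infty]$ for all $\zeta\in\mathcal{Z}$. The generalized entropy is $H(P):=\inf_{a\in\mathcal{A}}L(P,a)$. In the restricted game $\mathcal{G}^\Gamma$ Nature chooses $P\in\Gamma$, the Decision Maker chooses $\zeta\in\mathcal{Z}$, and the loss is $L(P,\zeta)$. Its lower value is $\underline{V}:=\sup_{P\in\Gamma}\inf_{\zeta\in\mathcal{Z}}L(P,\zeta)$ and its upper value is $\overline{V}:=\inf_{\zeta\in\mathcal{Z}}\sup_{P\in\Gamma}L(P,\zeta)$; it has value $V$ if $V=\underline{V}=\overline{V}$ is finite. A pair $(P^*,\zeta^* )\in\Gamma\times\mathcal{Z}$ is a saddle-point in $\mathcal{G}^\Gamma$ if $L(P^*,\zeta^* )$ is finite, $L(P^*,\zeta^* )\le L(P^*,\zeta)$ for all $\zeta\in\mathcal{Z}$, and $L(P^*,\zeta^* )\ge L(P,\zeta^* )$ for all $P\in\Gamma$. An act $\zeta^*\in\mathcal{Z}$ is robust Bayes against $\Gamma$ if it attains $\inf_{\zeta\in\mathcal{Z}}\sup_{P\in\Gamma}L(P,\zeta)$. *)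

theory Defs
  imports "HOL-Probability.Probability"
begin

text \<open>
  The extended expectation \<open>E f\<^sup>+ - E f\<^sup>-\<close>.  The function \<open>ext_expectation\<close> is total; its value
  is meaningful only where \<open>ext_defined\<close> holds (in \<^typ>\<open>ereal\<close>, \<open>\<infinity> - \<infinity> = \<infinity>\<close>).
\<close>

definition ext_defined :: "'b measure \<Rightarrow> ('b \<Rightarrow> ereal) \<Rightarrow> bool" where
  "ext_defined M f \<longleftrightarrow> f \<in> borel_measurable M \<and>
     \<not> ((\<integral>\<^sup>+ x. e2ennreal (max 0 (f x)) \<partial>M) = \<infinity> \<and>
        (\<integral>\<^sup>+ x. e2ennreal (max 0 (- f x)) \<partial>M) = \<infinity>)"

definition ext_expectation :: "'b measure \<Rightarrow> ('b \<Rightarrow> ereal) \<Rightarrow> ereal" where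
  "ext_expectation M f =
     enn2ereal (\<integral>\<^sup>+ x. e2ennreal (max 0 (f x)) \<partial>M) -
     enn2ereal (\<integral>\<^sup>+ x. e2ennreal (max 0 (- f x)) \<partial>M)"

text \<open>
  Of the measures \<open>X\<close> and \<open>A\<close> only the underlying measurable spaces are used.
\<close>

locale basic_game =
  fixes X :: "'x measure" and A :: "'a measure" and L :: "'x \<Rightarrow> 'a \<Rightarrow> ereal"
  assumes singleton_outcome: "\<And>x. x \<in> space X \<Longrightarrow> {x} \<in> sets X"
    and singleton_action: "\<And>a. a \<in> space A \<Longrightarrow> {a} \<in> sets A"
    and loss_measurable: "(\<lambda>(x, a). L x a) \<in> borel_measurable (X \<Otimes>\<^sub>M A)"
    and loss_not_MInfty: "\<And>x a. x \<in> space X \<Longrightarrow> a \<in> space A \<Longrightarrow> L x a \<noteq> -\<infinity>"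

definition loss_dist_act :: "('x \<Rightarrow> 'a \<Rightarrow> ereal) \<Rightarrow> 'x measure \<Rightarrow> 'a \<Rightarrow> ereal" where
  "loss_dist_act L P a = ext_expectation P (\<lambda>x. L x a)"

definition loss_outcome_rand :: "('x \<Rightarrow> 'a \<Rightarrow> ereal) \<Rightarrow> 'x \<Rightarrow> 'a measure \<Rightarrow> ereal" where
  "loss_outcome_rand L x \<zeta> = ext_expectation \<zeta> (\<lambda>a. L x a)"

definition loss_dist_rand :: "('x \<Rightarrow> 'a \<Rightarrow> ereal) \<Rightarrow> 'x measure \<Rightarrow> 'a measure \<Rightarrow> ereal" where
  "loss_dist_rand L P \<zeta> = ext_expectation (P \<Otimes>\<^sub>M \<zeta>) (\<lambda>(x, a). L x a)"

definition distributions ::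
  "'x measure \<Rightarrow> 'a measure \<Rightarrow> ('x \<Rightarrow> 'a \<Rightarrow> ereal) \<Rightarrow> 'x measure set" where
  "distributions X A L =
     {P \<in> space (prob_algebra X). \<forall>a\<in>space A. ext_defined P (\<lambda>x. L x a)}"

definition randomized_acts ::
  "'x measure \<Rightarrow> 'a measure \<Rightarrow> ('x \<Rightarrow> 'a \<Rightarrow> ereal) \<Rightarrow> 'a measure set" where
  "randomized_acts X A L =
     {\<zeta> \<in> space (prob_algebra A).
        \<forall>P\<in>distributions X A L. ext_defined (P \<Otimes>\<^sub>M \<zeta>) (\<lambda>(x, a). L x a)}"

text \<open>
  An expectation lying in \<open>[0,\<infinity>]\<close> is in particular defined, which includes that the
  difference of losses is not of the form \<open>\<infinity> - \<infinity>\<close> or \<open>-\<infinity> - (-\<infinity>)\<close>, except on a \<open>P\<close>-null set.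
\<close>

definition bayes_against ::
  "'x measure \<Rightarrow> 'a measure \<Rightarrow> ('x \<Rightarrow> 'a \<Rightarrow> ereal) \<Rightarrow> 'x measure \<Rightarrow> 'a measure \<Rightarrow> bool" where
  "bayes_against X A L P \<zeta>P \<longleftrightarrow> \<zeta>P \<in> randomized_acts X A L \<and>
     (\<forall>\<zeta>\<in>randomized_acts X A L.
        (AE x in P. \<not> (\<bar>loss_outcome_rand L x \<zeta>\<bar> = \<infinity> \<and>
                        loss_outcome_rand L x \<zeta> = loss_outcome_rand L x \<zeta>P)) \<and>
        ext_defined P (\<lambda>x. loss_outcome_rand L x \<zeta> - loss_outcome_rand L x \<zeta>P) \<and>
        0 \<le> ext_expectation P (\<lambda>x. loss_outcome_rand L x \<zeta> - loss_outcome_rand L x \<zeta>P))"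

definition gen_entropy ::
  "'a measure \<Rightarrow> ('x \<Rightarrow> 'a \<Rightarrow> ereal) \<Rightarrow> 'x measure \<Rightarrow> ereal" where
  "gen_entropy A L P = (INF a\<in>space A. loss_dist_act L P a)"

definition lower_value ::
  "'x measure \<Rightarrow> 'a measure \<Rightarrow> ('x \<Rightarrow> 'a \<Rightarrow> ereal) \<Rightarrow> 'x measure set \<Rightarrow> ereal" where
  "lower_value X A L \<Gamma> =
     (SUP P\<in>\<Gamma>. INF \<zeta>\<in>randomized_acts X A L. loss_dist_rand L P \<zeta>)"

definition upper_value ::
  "'x measure \<Rightarrow> 'a measure \<Rightarrow> ('x \<Rightarrow> 'a \<Rightarrow> ereal) \<Rightarrow> 'x measure set \<Rightarrow> ereal" where
  "upper_value X A L \<Gamma> =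
     (INF \<zeta>\<in>randomized_acts X A L. SUP P\<in>\<Gamma>. loss_dist_rand L P \<zeta>)"

definition has_value ::
  "'x measure \<Rightarrow> 'a measure \<Rightarrow> ('x \<Rightarrow> 'a \<Rightarrow> ereal) \<Rightarrow> 'x measure set \<Rightarrow> ereal \<Rightarrow> bool" where
  "has_value X A L \<Gamma> V \<longleftrightarrow>
     V = lower_value X A L \<Gamma> \<and> V = upper_value X A L \<Gamma> \<and> \<bar>V\<bar> \<noteq> \<infinity>"

definition saddle_point ::
  "'x measure \<Rightarrow> 'a measure \<Rightarrow> ('x \<Rightarrow> 'a \<Rightarrow> ereal) \<Rightarrow> 'x measure set \<Rightarrow>
    'x measure \<Rightarrow> 'a measure \<Rightarrow> bool" where
  "saddle_point X A L \<Gamma> P' \<zeta>' \<longleftrightarrow>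
     P' \<in> \<Gamma> \<and> \<zeta>' \<in> randomized_acts X A L \<and>
     \<bar>loss_dist_rand L P' \<zeta>'\<bar> \<noteq> \<infinity> \<and>
     (\<forall>\<zeta>\<in>randomized_acts X A L. loss_dist_rand L P' \<zeta>' \<le> loss_dist_rand L P' \<zeta>) \<and>
     (\<forall>P\<in>\<Gamma>. loss_dist_rand L P \<zeta>' \<le> loss_dist_rand L P' \<zeta>')"

definition robust_bayes ::
  "'x measure \<Rightarrow> 'a measure \<Rightarrow> ('x \<Rightarrow> 'a \<Rightarrow> ereal) \<Rightarrow> 'x measure set \<Rightarrow> 'a measure \<Rightarrow> bool" where
  "robust_bayes X A L \<Gamma> \<zeta>' \<longleftrightarrow>
     \<zeta>' \<in> randomized_acts X A L \<and>
     (SUP P\<in>\<Gamma>. loss_dist_rand L P \<zeta>') =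
       (INF \<zeta>\<in>randomized_acts X A L. SUP P\<in>\<Gamma>. loss_dist_rand L P \<zeta>)"

end

theory Submission
  imports Defs
begin

text \<open>
  The value and robust Bayes claims are formal consequences of the saddle-point inequalities.  By
  Tonelli's theorem applied to the positive and negative parts of the loss,
  \<open>L(P, \<zeta>)\<close> is the \<open>\<zeta>\<close>-average of \<open>a \<mapsto> L(P, a)\<close>, so it is at least \<open>H(P)\<close>; with point masses as
  acts this gives both entropy claims.  Averaging in the other order, the finiteness of
  \<open>L(P\<^sup>*, \<zeta>\<^sup>*)\<close> makes \<open>x \<mapsto> L(x, \<zeta>\<^sup>*)\<close> integrable, and \<open>L(P\<^sup>*, \<zeta>) \<ge> L(P\<^sup>*, \<zeta>\<^sup>*)\<close> makes the negative
  part of \<open>x \<mapsto> L(x, \<zeta>)\<close> integrable, so that the two expectations may be subtracted.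
\<close>

abbreviation pos_integral :: "'b measure \<Rightarrow> ('b \<Rightarrow> ereal) \<Rightarrow> ennreal" where
  "pos_integral M f \<equiv> \<integral>\<^sup>+ x. e2ennreal (max 0 (f x)) \<partial>M"

abbreviation neg_integral :: "'b measure \<Rightarrow> ('b \<Rightarrow> ereal) \<Rightarrow> ennreal" where
  "neg_integral M f \<equiv> \<integral>\<^sup>+ x. e2ennreal (max 0 (- f x)) \<partial>M"

text \<open>Terms are moved to the side on which they are nonnegative, giving an inequality in
  \<open>ennreal\<close> that can be integrated. Since \<open>ennreal\<close> sends negative reals
  to 0, \<open>ennreal h\<close> and \<open>ennreal (- h)\<close> are the positive and negative
  parts of \<open>h\<close>.\<close>

lemma ereal_le_enn2ereal_diffD:
  assumes "ereal h \<le> enn2ereal p - enn2ereal n"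
  shows "n + ennreal h \<le> p + ennreal (- h)"
  using assms
  by (cases p; cases n; cases "h \<ge> 0") (auto simp: ennreal_neg ennreal_plus[symmetric] top_add top_unique simp del: ennreal_plus)

lemma ereal_le_enn2ereal_diffI:
  assumes "n + ennreal h \<le> p + ennreal (- h)" "p \<noteq> \<infinity>"
  shows "ereal h \<le> enn2ereal p - enn2ereal n"
  using assms
  by (cases p; cases n; cases "h \<ge> 0") (auto simp: ennreal_neg ennreal_plus[symmetric] top_add top_unique simp del: ennreal_plus)

lemma enn2ereal_diff_nonneg:
  fixes p n :: ennreal
  assumes "n \<le> p" shows "0 \<le> enn2ereal p - enn2ereal n"
  using assms by (cases p; cases n) (auto simp: top_unique)

lemma enn2ereal_diff_mono_cross:
  assumes "enn2ereal q - enn2ereal m \<le> enn2ereal p - enn2ereal n" "q \<noteq> \<infinity>" "m \<noteq> \<infinity>"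
  shows "q + n \<le> p + m"
  using assms
  by (cases p; cases n; cases q; cases m)
     (auto simp: ennreal_plus[symmetric] top_add top_unique simp del: ennreal_plus)

text \<open>The positive and negative parts of \<open>d\<close> satisfy d+ - d- = (p + m) - (q + n),
  written here without subtraction. The value \<open>p\<close> = \<infinity> is allowed: then
  \<open>d\<close> = \<infinity> and d- = 0.\<close>

lemma enn2ereal_diff_parts:
  fixes p n q m :: ennreal
  assumes "n \<noteq> \<infinity>" "q \<noteq> \<infinity>" "m \<noteq> \<infinity>"
  defines "d \<equiv> (enn2ereal p - enn2ereal n) - (enn2ereal q - enn2ereal m)"
  shows "p + m + e2ennreal (max 0 (- d)) \<le> e2ennreal (max 0 d) + (q + n)"
    and "e2ennreal (max 0 (- d)) \<le> q + n"
  using assms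
  by (cases p; cases n; cases q; cases m;
      force simp: d_def ennreal_plus[symmetric] ennreal_neg max_def top_add
        simp del: ennreal_plus)+

lemma finite_ext_expectationD:
  assumes "ext_defined M f" "\<bar>ext_expectation M f\<bar> \<noteq> \<infinity>"
  shows "pos_integral M f \<noteq> \<infinity>" "neg_integral M f \<noteq> \<infinity>"
  using assms unfolding ext_defined_def ext_expectation_def
  by (cases "pos_integral M f"; cases "neg_integral M f"; auto)+

text \<open>Definedness is what excludes two infinite parts; the value alone would not, because
  \<infinity> - \<infinity> = \<infinity> in \<open>ereal\<close>.\<close>

lemma ext_expectation_gt_MInftyD:
  assumes "ext_defined M f" "ext_expectation M f \<noteq> -\<infinity>"
  shows "neg_integral M f \<noteq> \<infinity>"
  using assms unfolding ext_defined_def ext_expectation_def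
  by (cases "pos_integral M f"; cases "neg_integral M f") auto

lemma nn_integral_pair_return:
  assumes "a \<in> space A" "f \<in> borel_measurable (P \<Otimes>\<^sub>M A)"
  shows "(\<integral>\<^sup>+ z. f z \<partial>(P \<Otimes>\<^sub>M return A a)) = (\<integral>\<^sup>+ x. f (x, a) \<partial>P)"
proof -
  interpret R: prob_space "return A a"
    using assms(1) by (rule prob_space_return)
  have "sets (P \<Otimes>\<^sub>M return A a) = sets (P \<Otimes>\<^sub>M A)"
    by (intro sets_pair_measure_cong) auto
  then have [measurable]: "f \<in> borel_measurable (P \<Otimes>\<^sub>M return A a)"
    using assms(2) by (simp cong: measurable_cong_sets)
  have "(\<integral>\<^sup>+ z. f z \<partial>(P \<Otimes>\<^sub>M return A a)) = (\<integral>\<^sup>+ x. \<integral>\<^sup>+ b. f (x, b) \<partial>return A a \<partial>P)"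
    by (simp add: R.nn_integral_fst)
  also have "\<dots> = (\<integral>\<^sup>+ x. f (x, a) \<partial>P)"
    using assms by (intro nn_integral_cong nn_integral_return) auto
  finally show ?thesis .
qed

text \<open>This justifies treating actions as point masses: integrating either part of the loss
  over a Dirac measure just evaluates it at \<open>a\<close>.\<close>

lemma loss_dist_rand_return:
  assumes "a \<in> space A" "(\<lambda>(x, a). L x a) \<in> borel_measurable (P \<Otimes>\<^sub>M A)"
  shows "loss_dist_rand L P (return A a) = loss_dist_act L P a"
    and "ext_defined (P \<Otimes>\<^sub>M return A a) (\<lambda>(x, a). L x a) \<longleftrightarrow> ext_defined P (\<lambda>x. L x a)"
proof -
  note [measurable] = assms(2)
  have m: "(\<lambda>(x, a). L x a) \<in> borel_measurable (P \<Otimes>\<^sub>M return A a)"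
    using assms(2) by (simp cong: measurable_cong_sets sets_pair_measure_cong)
  have m': "(\<lambda>x. L x a) \<in> borel_measurable P"
    using measurable_compose[OF measurable_Pair2'[OF assms(1)] assms(2)] by simp
  have "pos_integral (P \<Otimes>\<^sub>M return A a) (\<lambda>(x, a). L x a) = pos_integral P (\<lambda>x. L x a)"
    "neg_integral (P \<Otimes>\<^sub>M return A a) (\<lambda>(x, a). L x a) = neg_integral P (\<lambda>x. L x a)"
    using assms(1) by (subst nn_integral_pair_return; simp)+
  then show "loss_dist_rand L P (return A a) = loss_dist_act L P a"
    and "ext_defined (P \<Otimes>\<^sub>M return A a) (\<lambda>(x, a). L x a) \<longleftrightarrow> ext_defined P (\<lambda>x. L x a)"
    using m m' by (simp_all add: loss_dist_rand_def loss_dist_act_def ext_expectation_def ext_defined_def)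
qed

text \<open>An average cannot fall below an infimum. To avoid infinite values, a real
  \<open>h\<close> strictly between the two sides is used: it bounds every L(P, a) from below, and
  this bound integrates over \<zeta>.\<close>

lemma gen_entropy_le_loss_dist_rand:
  assumes "prob_space P" "prob_space \<zeta>" "space \<zeta> = space A"
    and L[measurable]: "(\<lambda>(x, a). L x a) \<in> borel_measurable (P \<Otimes>\<^sub>M \<zeta>)"
  shows "gen_entropy A L P \<le> loss_dist_rand L P \<zeta>"
proof (rule ccontr)
  interpret P: prob_space P by fact
  interpret Z: prob_space \<zeta> by fact
  interpret pair_sigma_finite P \<zeta> ..
  let ?p = "\<lambda>a. pos_integral P (\<lambda>x. L x a)" and ?n = "\<lambda>a. neg_integral P (\<lambda>x. L x a)"
  let ?pp = "pos_integral (P \<Otimes>\<^sub>M \<zeta>) (\<lambda>(x, a). L x a)"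
    and ?nn = "neg_integral (P \<Otimes>\<^sub>M \<zeta>) (\<lambda>(x, a). L x a)"
  assume "\<not> gen_entropy A L P \<le> loss_dist_rand L P \<zeta>"
  then obtain h where h: "loss_dist_rand L P \<zeta> < ereal h" "ereal h < gen_entropy A L P"
    by (metis ereal_dense2 not_le)
  have fub: "?pp = (\<integral>\<^sup>+ a. ?p a \<partial>\<zeta>)" "?nn = (\<integral>\<^sup>+ a. ?n a \<partial>\<zeta>)"
    by (subst nn_integral_snd[symmetric]; simp)+
  have [measurable]: "?p \<in> borel_measurable \<zeta>" "?n \<in> borel_measurable \<zeta>"
    by measurable
  \<comment> \<open>In \<open>ereal\<close>, \<infinity> minus anything is \<infinity>, which is not
    below \<open>h\<close>.\<close>
  have pp: "?pp \<noteq> \<infinity>"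
    using h(1) by (auto simp: loss_dist_rand_def ext_expectation_def)
  have "?n a + ennreal h \<le> ?p a + ennreal (- h)" if "a \<in> space \<zeta>" for a
  proof (rule ereal_le_enn2ereal_diffD)
    have "gen_entropy A L P \<le> loss_dist_act L P a"
      using that assms(3) unfolding gen_entropy_def by (intro INF_lower) simp
    then show "ereal h \<le> enn2ereal (?p a) - enn2ereal (?n a)"
      using h(2) by (simp add: loss_dist_act_def ext_expectation_def)
  qed
  then have "(\<integral>\<^sup>+ a. ?n a + ennreal h \<partial>\<zeta>) \<le> (\<integral>\<^sup>+ a. ?p a + ennreal (- h) \<partial>\<zeta>)"
    by (rule nn_integral_mono)
  then have "?nn + ennreal h \<le> ?pp + ennreal (- h)"
    by (simp add: nn_integral_add fub Z.emeasure_space_1)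
  from ereal_le_enn2ereal_diffI[OF this pp] h(1) show False
    by (simp add: loss_dist_rand_def ext_expectation_def)
qed

text \<open>These are the conditions for \<open>\<zeta>'\<close> to be Bayes, checked against one
  competitor \<zeta>. The loss of \<zeta> may be \<infinity>, so the integral \<open>?pp\<close> of
  its positive part is never cancelled; the other three integrals are finite.\<close>

lemma loss_difference_expectation:
  assumes "prob_space P" "prob_space \<zeta>" "prob_space \<zeta>'"
    and L[measurable]: "(\<lambda>(x, a). L x a) \<in> borel_measurable (P \<Otimes>\<^sub>M \<zeta>)"
    and def: "ext_defined (P \<Otimes>\<^sub>M \<zeta>) (\<lambda>(x, a). L x a)"
    and L'[measurable]: "(\<lambda>(x, a). L x a) \<in> borel_measurable (P \<Otimes>\<^sub>M \<zeta>')"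
    and def': "ext_defined (P \<Otimes>\<^sub>M \<zeta>') (\<lambda>(x, a). L x a)"
    and fin: "\<bar>loss_dist_rand L P \<zeta>'\<bar> \<noteq> \<infinity>"
    and le: "loss_dist_rand L P \<zeta>' \<le> loss_dist_rand L P \<zeta>"
  defines "d \<equiv> \<lambda>x. loss_outcome_rand L x \<zeta> - loss_outcome_rand L x \<zeta>'"
  shows "AE x in P. \<bar>loss_outcome_rand L x \<zeta>'\<bar> \<noteq> \<infinity>"
    and "ext_defined P d"
    and "0 \<le> ext_expectation P d"
proof -
  interpret P: prob_space P by fact
  interpret Z: prob_space \<zeta> by fact
  interpret Z': prob_space \<zeta>' by fact
  interpret PZ: pair_sigma_finite P \<zeta> ..
  interpret PZ': pair_sigma_finite P \<zeta>' ..
  let ?p = "\<lambda>x. pos_integral \<zeta> (L x)" and ?n = "\<lambda>x. neg_integral \<zeta> (L x)"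
    and ?q = "\<lambda>x. pos_integral \<zeta>' (L x)" and ?m = "\<lambda>x. neg_integral \<zeta>' (L x)"
  let ?pp = "\<integral>\<^sup>+ x. ?p x \<partial>P" and ?nn = "\<integral>\<^sup>+ x. ?n x \<partial>P"
    and ?qq = "\<integral>\<^sup>+ x. ?q x \<partial>P" and ?mm = "\<integral>\<^sup>+ x. ?m x \<partial>P"
  have fub: "pos_integral (P \<Otimes>\<^sub>M \<zeta>) (\<lambda>(x, a). L x a) = ?pp"
    "neg_integral (P \<Otimes>\<^sub>M \<zeta>) (\<lambda>(x, a). L x a) = ?nn"
    by (subst Z.nn_integral_fst[symmetric]; simp)+
  have fub': "pos_integral (P \<Otimes>\<^sub>M \<zeta>') (\<lambda>(x, a). L x a) = ?qq"
    "neg_integral (P \<Otimes>\<^sub>M \<zeta>') (\<lambda>(x, a). L x a) = ?mm"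
    by (subst Z'.nn_integral_fst[symmetric]; simp)+
  have [measurable]: "?p \<in> borel_measurable P" "?n \<in> borel_measurable P"
    "?q \<in> borel_measurable P" "?m \<in> borel_measurable P"
    by measurable
  have q: "?qq \<noteq> \<infinity>" and m: "?mm \<noteq> \<infinity>"
    using finite_ext_expectationD[OF def' fin[unfolded loss_dist_rand_def]]
    by (simp_all add: fub')
  \<comment> \<open>The comparison with a finite loss bounds the loss of \<zeta> from below, which
    controls its negative part only.\<close>
  have "loss_dist_rand L P \<zeta> \<noteq> -\<infinity>"
    using fin le by auto
  then have n: "?nn \<noteq> \<infinity>"
    using ext_expectation_gt_MInftyD[OF def] by (simp add: loss_dist_rand_def fub)
  have cross: "?qq + ?nn \<le> ?pp + ?mm"
    using enn2ereal_diff_mono_cross[OF _ q m] le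
    by (simp add: loss_dist_rand_def ext_expectation_def fub fub')
  have d_eq: "d x = (enn2ereal (?p x) - enn2ereal (?n x)) - (enn2ereal (?q x) - enn2ereal (?m x))" for x
    by (simp add: d_def loss_outcome_rand_def ext_expectation_def)
  have [measurable]: "d \<in> borel_measurable P"
    unfolding d_eq[abs_def] by measurable
  \<comment> \<open>Finite integrals have almost everywhere finite integrands, which gives the
    pointwise hypotheses of \<open>enn2ereal_diff_parts\<close>.\<close>
  have AE: "AE x in P. ?n x \<noteq> \<infinity>" "AE x in P. ?q x \<noteq> \<infinity>" "AE x in P. ?m x \<noteq> \<infinity>"
    using nn_integral_PInf_AE[OF _ n] nn_integral_PInf_AE[OF _ q] nn_integral_PInf_AE[OF _ m]
    by simp_all
  show "AE x in P. \<bar>loss_outcome_rand L x \<zeta>'\<bar> \<noteq> \<infinity>"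
    using AE(2,3)
  proof eventually_elim
    case (elim x)
    then show ?case
      by (cases "?q x"; cases "?m x") (auto simp: loss_outcome_rand_def ext_expectation_def)
  qed
  have parts: "AE x in P. ?p x + ?m x + e2ennreal (max 0 (- d x)) \<le> e2ennreal (max 0 (d x)) + (?q x + ?n x)"
    using AE unfolding d_eq by eventually_elim (rule enn2ereal_diff_parts(1))
  have neg_le: "AE x in P. e2ennreal (max 0 (- d x)) \<le> ?q x + ?n x"
    using AE unfolding d_eq by eventually_elim (rule enn2ereal_diff_parts(2))
  have "neg_integral P d \<le> (\<integral>\<^sup>+ x. ?q x + ?n x \<partial>P)"
    by (intro nn_integral_mono_AE neg_le)
  also have sum: "\<dots> = ?qq + ?nn"
    by (rule nn_integral_add) measurable
  finally have neg: "neg_integral P d \<noteq> \<infinity>"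
    using q n by (auto simp: top_unique)
  then show "ext_defined P d"
    by (simp add: ext_defined_def)
  have "(\<integral>\<^sup>+ x. ?p x + ?m x + e2ennreal (max 0 (- d x)) \<partial>P)
      \<le> (\<integral>\<^sup>+ x. e2ennreal (max 0 (d x)) + (?q x + ?n x) \<partial>P)"
    by (intro nn_integral_mono_AE parts)
  then have "(?pp + ?mm) + neg_integral P d \<le> pos_integral P d + (?qq + ?nn)"
    by (simp add: nn_integral_add)
  \<comment> \<open>The assumed order of the losses replaces \<open>?pp + ?mm\<close> by the smaller
    \<open>?qq + ?nn\<close>, which is finite and hence cancels from both sides.\<close>
  with cross have "(?qq + ?nn) + neg_integral P d \<le> pos_integral P d + (?qq + ?nn)"
    by (blast intro: order_trans[OF add_right_mono])
  moreover have "?qq + ?nn \<noteq> \<infinity>"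
    using q n by simp
  ultimately have "neg_integral P d \<le> pos_integral P d"
    by (simp add: add.commute[of _ "?qq + ?nn"] ennreal_add_left_cancel_le)
  then show "0 \<le> ext_expectation P d"
    unfolding ext_expectation_def by (rule enn2ereal_diff_nonneg)
qed

theorem theorem4p1:
  fixes X :: "'x measure" and A :: "'a measure" and L :: "'x \<Rightarrow> 'a \<Rightarrow> ereal"
    and \<Gamma> :: "'x measure set" and Pstar :: "'x measure" and \<zeta>star :: "'a measure"
    and Hstar :: ereal
  assumes "basic_game X A L"
    and "\<Gamma> \<subseteq> distributions X A L"
    and "saddle_point X A L \<Gamma> Pstar \<zeta>star"
    and "Hstar = loss_dist_rand L Pstar \<zeta>star"
  shows "has_value X A L \<Gamma> Hstar
    \<and> bayes_against X A L Pstar \<zeta>star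
    \<and> gen_entropy A L Pstar = Hstar
    \<and> (\<forall>P\<in>\<Gamma>. gen_entropy A L P \<le> gen_entropy A L Pstar)
    \<and> robust_bayes X A L \<Gamma> \<zeta>star"
proof -
  interpret basic_game X A L by fact
  let ?Z = "randomized_acts X A L"
  have Pstar: "Pstar \<in> \<Gamma>" and \<zeta>star: "\<zeta>star \<in> ?Z" and fin: "\<bar>Hstar\<bar> \<noteq> \<infinity>"
    and min: "\<And>\<zeta>. \<zeta> \<in> ?Z \<Longrightarrow> Hstar \<le> loss_dist_rand L Pstar \<zeta>"
    and max: "\<And>P. P \<in> \<Gamma> \<Longrightarrow> loss_dist_rand L P \<zeta>star \<le> Hstar"
    using assms(3,4) by (auto simp: saddle_point_def)
  have meas: "(\<lambda>(x, a). L x a) \<in> borel_measurable (P \<Otimes>\<^sub>M B)"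
    if "sets P = sets X" "sets B = sets A" for P B
    using loss_measurable that by (simp cong: measurable_cong_sets sets_pair_measure_cong)
  have dist: "prob_space P" "sets P = sets X" if "P \<in> \<Gamma>" for P
    using that assms(2) by (auto simp: distributions_def space_prob_algebra)
  have act: "prob_space \<zeta>" "sets \<zeta> = sets A" if "\<zeta> \<in> ?Z" for \<zeta>
    using that by (auto simp: randomized_acts_def space_prob_algebra)
  have def: "ext_defined (P \<Otimes>\<^sub>M \<zeta>) (\<lambda>(x, a). L x a)" if "P \<in> \<Gamma>" "\<zeta> \<in> ?Z" for P \<zeta>
    using that assms(2) by (auto simp: randomized_acts_def)

  have inf: "(INF \<zeta>\<in>?Z. loss_dist_rand L Pstar \<zeta>) = Hstar"
    using assms(4) \<zeta>star min by (intro antisym INF_greatest INF_lower2[of \<zeta>star]) auto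
  have sup: "(SUP P\<in>\<Gamma>. loss_dist_rand L P \<zeta>star) = Hstar"
    using assms(4) Pstar max by (intro antisym SUP_least SUP_upper2[of Pstar]) auto
  have lower: "lower_value X A L \<Gamma> = Hstar"
    unfolding lower_value_def
  proof (rule antisym)
    show "(SUP P\<in>\<Gamma>. INF \<zeta>\<in>?Z. loss_dist_rand L P \<zeta>) \<le> Hstar"
      using \<zeta>star max by (intro SUP_least INF_lower2[of \<zeta>star])
    show "Hstar \<le> (SUP P\<in>\<Gamma>. INF \<zeta>\<in>?Z. loss_dist_rand L P \<zeta>)"
      using Pstar inf by (intro SUP_upper2[of Pstar]) auto
  qed
  have upper: "upper_value X A L \<Gamma> = Hstar"
    unfolding upper_value_def
  proof (rule antisym)
    show "(INF \<zeta>\<in>?Z. SUP P\<in>\<Gamma>. loss_dist_rand L P \<zeta>) \<le> Hstar"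
      using \<zeta>star sup by (intro INF_lower2[of \<zeta>star]) auto
    show "Hstar \<le> (INF \<zeta>\<in>?Z. SUP P\<in>\<Gamma>. loss_dist_rand L P \<zeta>)"
      using Pstar min by (intro INF_greatest SUP_upper2[of Pstar])
  qed

  have bayes: "bayes_against X A L Pstar \<zeta>star"
    unfolding bayes_against_def
  proof (intro conjI ballI \<zeta>star)
    fix \<zeta> assume \<zeta>: "\<zeta> \<in> ?Z"
    note * = loss_difference_expectation[OF dist(1)[OF Pstar] act(1)[OF \<zeta>] act(1)[OF \<zeta>star]
        meas[OF dist(2)[OF Pstar] act(2)[OF \<zeta>]] def[OF Pstar \<zeta>]
        meas[OF dist(2)[OF Pstar] act(2)[OF \<zeta>star]] def[OF Pstar \<zeta>star]
        fin[unfolded assms(4)] min[OF \<zeta>, unfolded assms(4)]]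
    \<comment> \<open>Almost everywhere the loss of \<open>\<zeta>star\<close> is finite, so it
      cannot equal an infinite loss of \<zeta>.\<close>
    show "AE x in Pstar. \<not> (\<bar>loss_outcome_rand L x \<zeta>\<bar> = \<infinity> \<and>
        loss_outcome_rand L x \<zeta> = loss_outcome_rand L x \<zeta>star)"
      using *(1) by eventually_elim auto
    show "ext_defined Pstar (\<lambda>x. loss_outcome_rand L x \<zeta> - loss_outcome_rand L x \<zeta>star)"
      "0 \<le> ext_expectation Pstar (\<lambda>x. loss_outcome_rand L x \<zeta> - loss_outcome_rand L x \<zeta>star)"
      by (fact *(2,3))+
  qed

  \<comment> \<open>The chain H(P) \<le> L(P, \<open>\<zeta>star\<close>) \<le> \<open>Hstar\<close>
    holds on all of \<Gamma>, so maximality of the entropy at \<open>Pstar\<close> follows once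
    \<open>Hstar\<close> is attained there.\<close>
  have entropy_le: "gen_entropy A L P \<le> Hstar" if "P \<in> \<Gamma>" for P
    using gen_entropy_le_loss_dist_rand[OF dist(1)[OF that] act(1)[OF \<zeta>star]
        sets_eq_imp_space_eq[OF act(2)[OF \<zeta>star]] meas[OF dist(2)[OF that] act(2)[OF \<zeta>star]]]
      max[OF that] by (rule order_trans)
  have "Hstar \<le> gen_entropy A L Pstar"
    unfolding gen_entropy_def
  proof (rule INF_greatest)
    fix a assume a: "a \<in> space A"
    \<comment> \<open>Being an act requires a defined loss against every member of
      \<open>distributions X A L\<close>, beyond \<Gamma>; for a point mass this is the condition
      defining that set.\<close>
    have "ext_defined (P \<Otimes>\<^sub>M return A a) (\<lambda>(x, a). L x a)" if "P \<in> distributions X A L" for P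
      using that a loss_dist_rand_return(2)[OF a meas[of P A]]
      by (auto simp: distributions_def space_prob_algebra)
    then have "return A a \<in> ?Z"
      using a by (auto simp: randomized_acts_def space_prob_algebra prob_space_return)
    from min[OF this] show "Hstar \<le> loss_dist_act L Pstar a"
      using loss_dist_rand_return(1)[OF a meas[OF dist(2)[OF Pstar] refl]] by simp
  qed
  then have entropy: "gen_entropy A L Pstar = Hstar"
    using entropy_le[OF Pstar] by (rule antisym[rotated])
  have "robust_bayes X A L \<Gamma> \<zeta>star"
    using \<zeta>star sup upper by (simp add: robust_bayes_def upper_value_def)
  then show ?thesis
    using lower upper fin bayes entropy entropy_le by (simp add: has_value_def)
qed

end
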